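(* Let $G$ be a simple connected graph with $|E(G)|\ge2$ and let $v\in V(G)$. Let $\bar G$ be obtained from $G$ by attaching three new pendant vertices $a,b,c$ to $v$, let $\widehat G=\bar G+\{a,b\}+\{b,c\}$, and let $G^*=\bar G+\{a,b\}+\{b,c\}+\{a,c\}$. Then $\mathscr{K}(G^* )>\mathscr{K}(\widehat G)$.
   Context: For connected $H$ with $m\ge1$ edges and degrees $d_i$, Kemeny's constant is $\mathscr{K}(H)=\sum_j\pi_jm_{ij}$ for the simple random walk on $H$ ($\pi_j=d_j/2m$, $m_{ij}$ expected hitting time of $j$ from $i$, $m_{jj}=0$), equivalently $\frac1{4m}\sum_{i,j}d_id_jr_H(i,j)$ with $r_H$ effective resistance. $H+\{x,y\}$ denotes $H$ with the edge $\{x,y\}$ added. *)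

theory Defs
  imports "HOL-Probability.Probability"
begin

record 'a sgraph =
  vertices :: "'a set"
  edges :: "'a set set"

definition simple_graph :: "'a sgraph \<Rightarrow> bool" where
  "simple_graph H \<longleftrightarrow>
     finite (vertices H) \<and>
     (\<forall>e\<in>edges H. \<exists>x\<in>vertices H. \<exists>y\<in>vertices H. x \<noteq> y \<and> e = {x, y})"

definition connected_graph :: "'a sgraph \<Rightarrow> bool" where
  "connected_graph H \<longleftrightarrow>
     vertices H \<noteq> {} \<and>
     (\<forall>x\<in>vertices H. \<forall>y\<in>vertices H. (x, y) \<in> {(s, t). {s, t} \<in> edges H}\<^sup>*)"

definition add_edge :: "'a sgraph \<Rightarrow> 'a \<Rightarrow> 'a \<Rightarrow> 'a sgraph" where
  "add_edge H x y = \<lparr>vertices = vertices H, edges = insert {x, y} (edges H)\<rparr>"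

definition add_pendant :: "'a sgraph \<Rightarrow> 'a \<Rightarrow> 'a \<Rightarrow> 'a sgraph" where
  "add_pendant H v p = \<lparr>vertices = insert p (vertices H), edges = insert {v, p} (edges H)\<rparr>"

definition nbrs :: "'a sgraph \<Rightarrow> 'a \<Rightarrow> 'a set" where
  "nbrs H x = {y. {x, y} \<in> edges H}"

definition deg :: "'a sgraph \<Rightarrow> 'a \<Rightarrow> nat" where
  "deg H x = card (nbrs H x)"

text \<open>The law of the trajectory \<open>[X\<^sub>0, \<dots>, X\<^sub>t]\<close> of the simple random walk started at \<open>X\<^sub>0 = i\<close>.\<close>

fun walk :: "'a sgraph \<Rightarrow> nat \<Rightarrow> 'a \<Rightarrow> 'a list pmf" where
  "walk H 0 i = return_pmf [i]"
| "walk H (Suc t) i = bind_pmf (pmf_of_set (nbrs H i)) (\<lambda>x. map_pmf (\<lambda>w. i # w) (walk H t x))"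

text \<open>The probability that the hitting time \<open>T\<^sub>j = min {t \<ge> 0. X\<^sub>t = j}\<close> equals \<open>t\<close>; this event
  depends only on \<open>X\<^sub>0, \<dots>, X\<^sub>t\<close>.\<close>

definition hit_prob :: "'a sgraph \<Rightarrow> 'a \<Rightarrow> 'a \<Rightarrow> nat \<Rightarrow> real" where
  "hit_prob H i j t = measure_pmf.prob (walk H t i) {w. w ! t = j \<and> (\<forall>s<t. w ! s \<noteq> j)}"

text \<open>The expectation of \<open>T\<^sub>j\<close>. On a finite connected graph with at least one edge \<open>T\<^sub>j\<close> is almost
  surely finite and the series converges; in other cases the value carries no meaning.\<close>

definition hitting_time :: "'a sgraph \<Rightarrow> 'a \<Rightarrow> 'a \<Rightarrow> real" where
  "hitting_time H i j = (\<Sum>t. real t * hit_prob H i j t)"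

definition stat_dist :: "'a sgraph \<Rightarrow> 'a \<Rightarrow> real" where
  "stat_dist H j = real (deg H j) / (2 * real (card (edges H)))"

text \<open>The common value, over all starting vertices \<open>i\<close>, of \<open>\<Sum>\<^sub>j \<pi>\<^sub>j m\<^sub>i\<^sub>j\<close>.\<close>

definition kemeny :: "'a sgraph \<Rightarrow> real" where
  "kemeny H = (THE k. \<forall>i\<in>vertices H. (\<Sum>j\<in>vertices H. stat_dist H j * hitting_time H i j) = k)"

end

theory Submission
  imports Defs
begin

text \<open>
  With the Laplacian \<open>L g(x) = d\<^sub>x g(x) - \<Sum>\<^sub>y\<^sub>~\<^sub>x g(y)\<close>, the hitting times of \<open>j\<close> in a graph with \<open>m\<close> edges
  form the unique function that vanishes at \<open>j\<close> and satisfies \<open>L g(x) = d\<^sub>x - 2m [x = j]\<close>. Hence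
  \<open>\<Sum>\<^sub>j d\<^sub>j h(i,j)\<close> is harmonic in \<open>i\<close>, so constant. If a graph \<open>F\<close> with \<open>f\<close> edges is glued to \<open>G\<close> at
  a cut vertex \<open>v\<close>, uniqueness gives \<open>h(v,j) = h\<^sub>G(v,j) + (f/m) (h\<^sub>G(v,j) + h\<^sub>G(j,v))\<close> for \<open>j\<close> in \<open>G\<close>, and
  symmetrically for \<open>j\<close> in \<open>F\<close>. Gluing \<open>K\<^sub>4\<close> minus an edge and \<open>K\<^sub>4\<close>, the difference of the two Kemeny
  constants has the sign of \<open>T + m\<^sup>2 + m/2 - 6\<close>, where \<open>T = \<Sum>\<^sub>j d\<^sub>j h\<^sub>G(j,v) \<ge> 2m - d\<^sub>v \<ge> m \<ge> 2\<close>.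
\<close>

section \<open>The graph Laplacian and edge counting\<close>

definition lap :: "'a sgraph \<Rightarrow> ('a \<Rightarrow> real) \<Rightarrow> 'a \<Rightarrow> real" where
  "lap H g x = real (deg H x) * g x - (\<Sum>y\<in>nbrs H x. g y)"

lemma lap_add: "lap H (\<lambda>x. f x + g x) x = lap H f x + lap H g x"
  by (simp add: lap_def sum.distrib algebra_simps)

lemma lap_diff: "lap H (\<lambda>x. f x - g x) x = lap H f x - lap H g x"
  by (simp add: lap_def sum_subtractf algebra_simps)

lemma lap_cmult: "lap H (\<lambda>x. k * g x) x = k * lap H g x"
  by (simp add: lap_def sum_distrib_left algebra_simps)

lemma lap_const: "lap H (\<lambda>x. k) x = 0"
  by (simp add: lap_def deg_def)

lemma lap_sum: "lap H (\<lambda>x. \<Sum>j\<in>J. f j x) x = (\<Sum>j\<in>J. lap H (f j) x)"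
  unfolding lap_def sum_distrib_left sum_subtractf sum.swap[of _ J] ..

lemma nbrs_sym: "y \<in> nbrs H x \<longleftrightarrow> x \<in> nbrs H y"
  by (simp add: nbrs_def insert_commute)

context
  fixes H :: "'a sgraph"
  assumes simple: "simple_graph H"
begin

lemma nbrs_subset: "nbrs H x \<subseteq> vertices H"
proof
  fix y assume "y \<in> nbrs H x"
  then obtain p q where "p \<in> vertices H" "q \<in> vertices H" "{x, y} = {p, q}"
    using simple by (auto simp: simple_graph_def nbrs_def)
  thus "y \<in> vertices H" by (auto simp: doubleton_eq_iff)
qed

lemma nbrs_outside: "x \<notin> vertices H \<Longrightarrow> nbrs H x = {}"
  using nbrs_subset nbrs_sym[of _ H x] by blast

lemma nbrs_irrefl: "x \<notin> nbrs H x"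
proof
  assume "x \<in> nbrs H x"
  then obtain p q where "p \<noteq> q" "{x} = {p, q}"
    using simple by (auto simp: simple_graph_def nbrs_def)
  thus False by (metis insertCI singletonD)
qed

lemma finite_vertices: "finite (vertices H)"
  using simple by (simp add: simple_graph_def)

lemma finite_nbrs: "finite (nbrs H x)"
  using nbrs_subset finite_vertices finite_subset by blast

lemma finite_edges: "finite (edges H)"
proof -
  have "edges H \<subseteq> Pow (vertices H)"
    using simple by (auto simp: simple_graph_def)
  thus ?thesis using finite_vertices by (simp add: finite_subset)
qed

lemma card_incident: "card {e \<in> edges H. x \<in> e} = deg H x"
proof -
  have "{e \<in> edges H. x \<in> e} = (\<lambda>y. {x, y}) ` nbrs H x"
  proof (intro equalityI subsetI)
    fix e assume e: "e \<in> {e \<in> edges H. x \<in> e}"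
    then obtain p q where "e = {p, q}" using simple by (auto simp: simple_graph_def)
    with e have "\<exists>y. e = {x, y}" by auto
    with e show "e \<in> (\<lambda>y. {x, y}) ` nbrs H x" by (auto simp: nbrs_def)
  qed (auto simp: nbrs_def)
  moreover have "inj_on (\<lambda>y. {x, y}) (nbrs H x)"
    by (auto simp: inj_on_def doubleton_eq_iff)
  ultimately show ?thesis by (simp add: deg_def card_image)
qed

lemma deg_le_card_edges: "deg H x \<le> card (edges H)"
  using card_mono[OF finite_edges, of "{e \<in> edges H. x \<in> e}"] card_incident[of x] by auto

lemma handshake: "(\<Sum>x\<in>vertices H. deg H x) = 2 * card (edges H)"
proof -
  have "(\<Sum>x\<in>vertices H. deg H x) = (\<Sum>x\<in>vertices H. \<Sum>e | e \<in> edges H \<and> x \<in> e. 1)"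
    by (simp flip: card_incident)
  also have "\<dots> = (\<Sum>e\<in>edges H. \<Sum>x | x \<in> vertices H \<and> x \<in> e. 1)"
    by (rule sum.swap_restrict[OF finite_vertices finite_edges])
  also have "\<dots> = (\<Sum>e\<in>edges H. 2)"
  proof (rule sum.cong[OF refl])
    fix e assume "e \<in> edges H"
    then obtain x y where xy: "x \<in> vertices H" "y \<in> vertices H" "x \<noteq> y" "e = {x, y}"
      using simple by (auto simp: simple_graph_def)
    hence "{z \<in> vertices H. z \<in> e} = {x, y}" by auto
    with xy show "(\<Sum>x | x \<in> vertices H \<and> x \<in> e. 1) = (2::nat)" by simp
  qed
  finally show ?thesis by simp
qed

text \<open>Swapping the double sum counts each \<open>g y\<close> once per neighbour of
  \<open>y\<close>. This later forces the Laplacian of a hitting time at its target, where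
  first-step analysis gives no equation.\<close>

lemma sum_lap: "(\<Sum>x\<in>vertices H. lap H g x) = 0"
proof -
  have "(\<Sum>x\<in>vertices H. \<Sum>y\<in>nbrs H x. g y)
      = (\<Sum>x\<in>vertices H. \<Sum>y | y \<in> vertices H \<and> y \<in> nbrs H x. g y)"
    using nbrs_subset by (intro sum.cong) auto
  also have "\<dots> = (\<Sum>y\<in>vertices H. \<Sum>x | x \<in> vertices H \<and> y \<in> nbrs H x. g y)"
    by (rule sum.swap_restrict[OF finite_vertices finite_vertices])
  also have "\<dots> = (\<Sum>y\<in>vertices H. real (deg H y) * g y)"
  proof (rule sum.cong[OF refl])
    fix y
    have "{x \<in> vertices H. y \<in> nbrs H x} = nbrs H y"
      using nbrs_subset nbrs_sym[of y] by blast
    thus "(\<Sum>x | x \<in> vertices H \<and> y \<in> nbrs H x. g y) = real (deg H y) * g y"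
      by (simp add: deg_def)
  qed
  finally show ?thesis by (simp add: lap_def sum_subtractf)
qed

lemma lap_cong:
  assumes "\<And>y. y \<in> vertices H \<Longrightarrow> f y = g y"
  shows "lap H f x = lap H g x"
proof (cases "x \<in> vertices H")
  case True
  have "(\<Sum>y\<in>nbrs H x. f y) = (\<Sum>y\<in>nbrs H x. g y)"
    using assms nbrs_subset by (intro sum.cong) auto
  thus ?thesis using True assms by (simp add: lap_def)
next
  case False
  \<comment> \<open>Both sides vanish off the graph. The gluing argument needs this case, since it
    evaluates the Laplacian of each piece at vertices of the other.\<close>
  thus ?thesis using nbrs_outside by (simp add: lap_def deg_def)
qed

end

section \<open>The first-step recursion\<close>

lemma hit_prob_0: "hit_prob H i j 0 = (if i = j then 1 else 0)"
  by (simp add: hit_prob_def indicator_def)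

text \<open>Conditioning on the first move: \<open>i # w\<close> first reaches \<open>j\<close> at
  time \<open>Suc t\<close> iff \<open>i\<close> is not \<open>j\<close> and \<open>w\<close> first
  reaches it at time \<open>t\<close>.\<close>

lemma hit_prob_Suc:
  assumes "finite (nbrs H i)" "nbrs H i \<noteq> {}"
  shows "hit_prob H i j (Suc t)
    = (if i = j then 0 else (\<Sum>y\<in>nbrs H i. hit_prob H y j t) / real (deg H i))"
proof -
  define E where "E t = {w. w ! t = j \<and> (\<forall>s<t. w ! s \<noteq> j)}" for t :: nat
  \<comment> \<open>Events become Boolean-valued distributions, so that the laws of map and bind
    apply.\<close>
  have prob: "measure_pmf.prob p A = pmf (map_pmf (\<lambda>w. w \<in> A) p) True" for p :: "'a list pmf" and A
    by (simp add: pmf_map vimage_def)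
  have Cons: "i # w \<in> E (Suc t) \<longleftrightarrow> i \<noteq> j \<and> w \<in> E t" for w
    by (auto simp: E_def less_Suc_eq_0_disj)
  have "hit_prob H i j (Suc t)
      = pmf (pmf_of_set (nbrs H i) \<bind> (\<lambda>x. map_pmf (\<lambda>w. i \<noteq> j \<and> w \<in> E t) (walk H t x))) True"
    by (simp add: hit_prob_def prob flip: E_def) (simp add: map_bind_pmf map_pmf_comp Cons)
  also have "\<dots> = (\<Sum>y\<in>nbrs H i. pmf (map_pmf (\<lambda>w. i \<noteq> j \<and> w \<in> E t) (walk H t y)) True) / deg H i"
    using assms by (simp add: pmf_bind integral_pmf_of_set deg_def)
  also have "\<dots> = (if i = j then 0 else (\<Sum>y\<in>nbrs H i. hit_prob H y j t) / real (deg H i))"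
    by (auto simp: hit_prob_def prob map_pmf_const simp flip: E_def)
  finally show ?thesis .
qed

section \<open>Connected graphs and the maximum principle\<close>

locale walk_graph =
  fixes H :: "'a sgraph"
  assumes simple: "simple_graph H" and conn: "connected_graph H" and edges_ne: "edges H \<noteq> {}"
begin

abbreviation V where "V \<equiv> vertices H"
abbreviation m where "m \<equiv> card (edges H)"

lemma m_pos: "m > 0"
  using edges_ne finite_edges[OF simple] by (simp add: card_gt_0_iff)

lemma path: "x \<in> V \<Longrightarrow> y \<in> V \<Longrightarrow> (x, y) \<in> {(s, t). t \<in> nbrs H s}\<^sup>*"
  using conn by (simp add: connected_graph_def nbrs_def)

text \<open>An edge provides a second vertex, and a path to it must start with a neighbour of
  \<open>x\<close>.\<close>

lemma nbrs_ne: assumes "x \<in> V" shows "nbrs H x \<noteq> {}"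
proof -
  obtain p q where "p \<in> V" "q \<in> V" "p \<noteq> q"
    using edges_ne simple unfolding simple_graph_def by blast
  then obtain y where "y \<in> V" "y \<noteq> x" by metis
  thus ?thesis using path[OF assms] by (metis (mono_tags, lifting) case_prodD converse_rtranclE
    emptyE mem_Collect_eq)
qed

lemma deg_pos: "x \<in> V \<Longrightarrow> deg H x > 0"
  using nbrs_ne finite_nbrs[OF simple] by (simp add: deg_def card_gt_0_iff)

text \<open>Where the Laplacian is at most 0, \<open>g\<close> is at most its neighbour average, so
  a maximum spreads from a vertex other than \<open>j\<close> to all its neighbours and, along a
  path, reaches \<open>j\<close>.\<close>

lemma maximum_principle:
  assumes sub: "\<And>x. x \<in> V \<Longrightarrow> x \<noteq> j \<Longrightarrow> lap H g x \<le> 0" and j: "j \<in> V" and i: "i \<in> V"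
  shows "g i \<le> g j"
proof -
  define M where "M = Max (g ` V)"
  have M: "g x \<le> M" if "x \<in> V" for x
    using that finite_vertices[OF simple] by (simp add: M_def)
  have "M \<in> g ` V"
    using finite_vertices[OF simple] i unfolding M_def by (intro Max_in) auto
  then obtain x where x: "x \<in> V" "g x = M" by auto
  have max_step: "g z = M" if y: "y \<in> V" "y \<noteq> j" "g y = M" and z: "z \<in> nbrs H y" for y z
  proof -
    have "(\<Sum>z\<in>nbrs H y. M - g z) = lap H g y"
      using y(3) by (simp add: lap_def deg_def sum_subtractf)
    hence "(\<Sum>z\<in>nbrs H y. M - g z) \<le> 0" using sub[OF y(1,2)] by simp
    moreover have nn: "M - g z \<ge> 0" if "z \<in> nbrs H y" for z
      using that nbrs_subset[OF simple] M by (auto simp: subset_iff)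
    ultimately have "(\<Sum>z\<in>nbrs H y. M - g z) = 0" by (meson order_antisym sum_nonneg)
    thus ?thesis using nn z finite_nbrs[OF simple] by (simp add: sum_nonneg_eq_0_iff)
  qed
  \<comment> \<open>The second disjunct covers paths that meet \<open>j\<close> early, since
    \<open>max_step\<close> does not lead past \<open>j\<close>.\<close>
  have "y \<in> V \<and> (g y = M \<or> g j = M)" if "(x, y) \<in> {(s, t). t \<in> nbrs H s}\<^sup>*" for y
    using that
  proof (induction rule: rtrancl_induct)
    case (step y z)
    thus ?case using max_step nbrs_subset[OF simple] by blast
  qed (use x in simp)
  hence "g j = M" using path[OF x(1) j] by blast
  thus ?thesis using M[OF i] by simp
qed

text \<open>The witness is the reversed graph distance to \<open>j\<close>; it will serve as an
  exponent.\<close>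

lemma rank_exists:
  assumes "j \<in> V"
  shows "\<exists>\<rho> :: 'a \<Rightarrow> nat. \<forall>x\<in>V. x \<noteq> j \<longrightarrow> (\<exists>y\<in>nbrs H x. \<rho> x < \<rho> y)"
proof -
  define R where "R = {(s, t). t \<in> nbrs H s}"
  define d where "d x = (LEAST k. (x, j) \<in> R ^^ k)" for x
  have d: "(x, j) \<in> R ^^ d x" if "x \<in> V" for x
    using path[OF that assms] LeastI_ex[of "\<lambda>k. (x, j) \<in> R ^^ k"]
    by (auto simp: d_def R_def rtrancl_power)
  have dec: "\<exists>y\<in>nbrs H x. d y < d x" if x: "x \<in> V" "x \<noteq> j" for x
  proof -
    obtain k where k: "d x = Suc k" using d[OF x(1)] x(2) by (cases "d x") auto
    with d[OF x(1)] obtain y where "(x, y) \<in> R" "(y, j) \<in> R ^^ k"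
      by (metis relpow_Suc_D2)
    moreover from this have "d y \<le> k" unfolding d_def by (intro Least_le)
    ultimately show ?thesis using k by (auto simp: R_def less_Suc_eq_le)
  qed
  define D where "D = Max (d ` V)"
  have "d x \<le> D" if "x \<in> V" for x
    using that finite_vertices[OF simple] by (simp add: D_def)
  \<comment> \<open>Truncated subtraction stays strict because \<open>d y < d x\<close> and
    \<open>d x\<close> is at most \<open>D\<close>.\<close>
  hence "\<exists>y\<in>nbrs H x. D - d x < D - d y" if "x \<in> V" "x \<noteq> j" for x
    using dec[OF that] that by (metis diff_less_mono2 order_less_le_trans)
  thus ?thesis by (intro exI[of _ "\<lambda>x. D - d x"]) simp
qed

text \<open>Weights growing geometrically towards \<open>j\<close>: a single neighbour closer to \<open>j\<close> then outweighs all
  the others. The resulting supersolution bounds the truncated expectations of the hitting time.\<close>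

lemma supersolution_exists:
  assumes j: "j \<in> V"
  shows "\<exists>g. \<forall>x\<in>V. g x \<ge> 0 \<and> (x \<noteq> j \<longrightarrow> lap H g x \<ge> real (deg H x))"
proof -
  obtain \<rho> :: "'a \<Rightarrow> nat" where \<rho>: "\<And>x. x \<in> V \<Longrightarrow> x \<noteq> j \<Longrightarrow> \<exists>y\<in>nbrs H x. \<rho> x < \<rho> y"
    using rank_exists[OF j] by metis
  \<comment> \<open>The base \<open>2 * m\<close> pays for the degree, at most \<open>m\<close>, and
    for \<open>w x + 1\<close>, at most \<open>2 * w x\<close>.\<close>
  define w where "w x = (2 * real m) ^ \<rho> x" for x
  define C where "C = Max (w ` V)"
  have w1: "w x \<ge> 1" for x unfolding w_def using m_pos by (intro one_le_power) simp
  have C: "w x \<le> C" if "x \<in> V" for x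
    using that finite_vertices[OF simple] by (simp add: C_def)
  have "lap H (\<lambda>x. C - w x) x \<ge> real (deg H x)" if x: "x \<in> V" "x \<noteq> j" for x
  proof -
    obtain y where y: "y \<in> nbrs H x" "\<rho> x < \<rho> y" using \<rho>[OF x] by blast
    have dm: "real (deg H x) \<le> m" using deg_le_card_edges[OF simple] by simp
    have "real (deg H x) * (w x + 1) \<le> m * (w x + w x)"
      using w1[of x] dm by (intro mult_mono) auto
    also have "\<dots> = (2 * real m) ^ Suc (\<rho> x)" by (simp add: w_def)
    also have "\<dots> \<le> w y" unfolding w_def using y(2) m_pos by (intro power_increasing) auto
    also have "\<dots> \<le> (\<Sum>z\<in>nbrs H x. w z)"
      using y(1) finite_nbrs[OF simple] w1 by (intro member_le_sum) (auto intro: order_trans[OF zero_le_one])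
    finally show ?thesis by (simp add: lap_diff lap_const) (simp add: lap_def algebra_simps)
  qed
  thus ?thesis using C by (intro exI[of _ "\<lambda>x. C - w x"]) simp
qed

section \<open>Convergence of the hitting time series\<close>

lemma hit_prob_nonneg: "hit_prob H i j t \<ge> 0"
  by (simp add: hit_prob_def)

lemma hit_prob_step:
  "i \<in> V \<Longrightarrow> hit_prob H i j (Suc t)
    = (if i = j then 0 else (\<Sum>y\<in>nbrs H i. hit_prob H y j t) / real (deg H i))"
  by (rule hit_prob_Suc[OF finite_nbrs[OF simple] nbrs_ne])

lemma hit_prob_same: "j \<in> V \<Longrightarrow> hit_prob H j j t = (if t = 0 then 1 else 0)"
  by (cases t) (simp_all add: hit_prob_0 hit_prob_step)

text \<open>For different \<open>t\<close> the probabilities belong to different trajectory laws, so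
  the bound comes from the recursion rather than from disjointness of events.\<close>

lemma sum_hit_prob_le_1: "i \<in> V \<Longrightarrow> (\<Sum>t<n. hit_prob H i j t) \<le> 1"
proof (induction n arbitrary: i)
  case (Suc n)
  show ?case
  proof (cases "i = j")
    case True
    with Suc.prems show ?thesis by (simp add: hit_prob_same)
  next
    case False
    have "(\<Sum>t<Suc n. hit_prob H i j t) = (\<Sum>t<n. \<Sum>y\<in>nbrs H i. hit_prob H y j t) / deg H i"
      using False Suc.prems
      by (simp only: sum.lessThan_Suc_shift) (simp add: hit_prob_0 hit_prob_step sum_divide_distrib)
    also have "\<dots> = (\<Sum>y\<in>nbrs H i. \<Sum>t<n. hit_prob H y j t) / deg H i"
      by (subst sum.swap) simp
    also have "\<dots> \<le> (\<Sum>y\<in>nbrs H i. 1) / deg H i"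
      using Suc.IH nbrs_subset[OF simple] by (intro divide_right_mono sum_mono) auto
    also have "\<dots> = 1" using deg_pos[OF Suc.prems] by (simp add: deg_def)
    finally show ?thesis .
  qed
qed simp

lemma summable_hit_prob: "i \<in> V \<Longrightarrow> summable (hit_prob H i j)"
  by (rule bounded_imp_summable[of _ 1])
    (use sum_hit_prob_le_1[of i j "Suc _"] hit_prob_nonneg in \<open>simp_all add: lessThan_Suc_atMost\<close>)

text \<open>The probability of ever reaching \<open>j\<close> is harmonic off \<open>j\<close>. The
  maximum principle for its negative bounds it below by its value at \<open>j\<close>, which is
  1.\<close>

lemma suminf_hit_prob:
  assumes "i \<in> V" "j \<in> V" shows "suminf (hit_prob H i j) = 1"
proof -
  define P where "P x = - suminf (hit_prob H x j)" for x
  have "lap H P x = 0" if x: "x \<in> V" "x \<noteq> j" for x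
  proof -
    have "suminf (hit_prob H x j) = (\<Sum>t. hit_prob H x j (Suc t)) + hit_prob H x j 0"
      using suminf_split_head[OF summable_hit_prob[OF x(1)]] by simp
    also have "\<dots> = (\<Sum>t. (\<Sum>y\<in>nbrs H x. hit_prob H y j t) / deg H x)"
      using x by (simp add: hit_prob_step hit_prob_0)
    also have "\<dots> = (\<Sum>y\<in>nbrs H x. suminf (hit_prob H y j)) / deg H x"
      using nbrs_subset[OF simple] summable_hit_prob
      by (subst suminf_divide, intro summable_sum, force) (subst suminf_sum, force, simp)
    finally show ?thesis using deg_pos[OF x(1)] by (simp add: lap_def P_def sum_negf)
  qed
  hence "P i \<le> P j" using maximum_principle[of j P i] assms by simp
  moreover have "suminf (hit_prob H j j) = 1"
    using assms sums_single[of 0 "\<lambda>_. 1::real"]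
    by (simp add: hit_prob_same sums_iff cong: suminf_cong)
  moreover have "suminf (hit_prob H i j) \<le> 1"
    using assms by (intro suminf_le_const summable_hit_prob sum_hit_prob_le_1)
  ultimately show ?thesis by (simp add: P_def)
qed

text \<open>Splitting \<open>Suc t\<close> as \<open>t + 1\<close> separates the first step from the
  time after it; summed over \<open>t\<close>, the second term is a total probability.\<close>

lemma sum_time_hit_prob_step:
  assumes "i \<in> V" "i \<noteq> j"
  shows "real (Suc t) * hit_prob H i j (Suc t)
    = (\<Sum>y\<in>nbrs H i. real t * hit_prob H y j t + hit_prob H y j t) / deg H i"
proof -
  have "(\<Sum>y\<in>nbrs H i. real t * hit_prob H y j t + hit_prob H y j t)
      = real (Suc t) * (\<Sum>y\<in>nbrs H i. hit_prob H y j t)"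
    unfolding sum_distrib_left by (intro sum.cong) (simp_all add: algebra_simps)
  thus ?thesis using assms by (simp only: hit_prob_step) simp
qed

text \<open>By induction on the truncation, the partial sums stay below a supersolution, uniformly
  in \<open>n\<close>.\<close>

lemma summable_hitting_time:
  assumes "i \<in> V" "j \<in> V" shows "summable (\<lambda>t. real t * hit_prob H i j t)"
proof -
  obtain g :: "'a \<Rightarrow> real" where g: "\<And>x. x \<in> V \<Longrightarrow> g x \<ge> 0"
    "\<And>x. x \<in> V \<Longrightarrow> x \<noteq> j \<Longrightarrow> lap H g x \<ge> real (deg H x)"
    using supersolution_exists[OF assms(2)] by metis
  have bound: "(\<Sum>t<n. real t * hit_prob H x j t) \<le> g x" if "x \<in> V" for n x
    using that
  proof (induction n arbitrary: x)
    case (Suc n)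
    show ?case
    proof (cases "x = j")
      case True
      with Suc.prems have "(\<Sum>t<Suc n. real t * hit_prob H x j t) = 0"
        by (intro sum.neutral) (simp add: hit_prob_same)
      with g(1)[OF Suc.prems] show ?thesis by simp
    next
      case False
      note d = deg_pos[OF Suc.prems]
      have "(\<Sum>t<Suc n. real t * hit_prob H x j t)
          = (\<Sum>t<n. \<Sum>y\<in>nbrs H x. real t * hit_prob H y j t + hit_prob H y j t) / deg H x"
        by (simp only: sum.lessThan_Suc_shift sum_time_hit_prob_step[OF Suc.prems False])
          (simp add: sum_divide_distrib)
      also have "\<dots> = (\<Sum>y\<in>nbrs H x. (\<Sum>t<n. real t * hit_prob H y j t) + (\<Sum>t<n. hit_prob H y j t)) / deg H x"
        by (subst sum.swap) (simp add: sum.distrib)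
      also have "\<dots> \<le> (\<Sum>y\<in>nbrs H x. g y + 1) / deg H x"
        using nbrs_subset[OF simple, of x]
        by (intro divide_right_mono sum_mono add_mono Suc.IH sum_hit_prob_le_1) auto
      \<comment> \<open>The supersolution inequality says that \<open>g x\<close> is at least 1 plus
        the neighbour average of \<open>g\<close>.\<close>
      also have "\<dots> \<le> g x"
        using g(2)[OF Suc.prems False] d by (simp add: lap_def deg_def sum.distrib field_simps)
      finally show ?thesis .
    qed
  qed (use g in simp)
  show ?thesis
    by (rule bounded_imp_summable[of _ "g i"])
      (use bound[OF assms(1), of "Suc _"] hit_prob_nonneg in \<open>simp_all add: lessThan_Suc_atMost\<close>)
qed

section \<open>Hitting times and Kemeny's constant through the Laplacian\<close>

lemma hitting_time_nonneg: "i \<in> V \<Longrightarrow> j \<in> V \<Longrightarrow> hitting_time H i j \<ge> 0"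
  unfolding hitting_time_def
  by (intro suminf_nonneg summable_hitting_time mult_nonneg_nonneg hit_prob_nonneg) auto

lemma hitting_time_same: "j \<in> V \<Longrightarrow> hitting_time H j j = 0"
proof -
  assume "j \<in> V"
  hence "(\<lambda>t. real t * hit_prob H j j t) = (\<lambda>_. 0)" by (auto simp: hit_prob_same)
  thus ?thesis by (simp add: hitting_time_def)
qed

text \<open>The hitting time is 1 plus its neighbour average; the 1 is the total probability from
  \<open>suminf_hit_prob\<close>.\<close>

lemma lap_hitting_time_off:
  assumes x: "x \<in> V" "x \<noteq> j" and j: "j \<in> V"
  shows "lap H (\<lambda>x. hitting_time H x j) x = deg H x"
proof -
  have nV: "y \<in> V" if "y \<in> nbrs H x" for y using that nbrs_subset[OF simple] by auto
  have "hitting_time H x j = (\<Sum>t. real (Suc t) * hit_prob H x j (Suc t))"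
    using suminf_split_head[OF summable_hitting_time[OF x(1) j]] by (simp add: hitting_time_def)
  also have "\<dots> = (\<Sum>t. (\<Sum>y\<in>nbrs H x. real t * hit_prob H y j t + hit_prob H y j t) / deg H x)"
    by (simp only: sum_time_hit_prob_step[OF x])
  also have "\<dots> = (\<Sum>t. (\<Sum>y\<in>nbrs H x. real t * hit_prob H y j t + hit_prob H y j t)) / deg H x"
    using nV j by (intro suminf_divide summable_sum summable_add summable_hit_prob summable_hitting_time)
  also have "\<dots> = (\<Sum>y\<in>nbrs H x. \<Sum>t. real t * hit_prob H y j t + hit_prob H y j t) / deg H x"
    using nV j by (subst suminf_sum) (auto intro!: summable_add summable_hit_prob summable_hitting_time)
  also have "\<dots> = (\<Sum>y\<in>nbrs H x. hitting_time H y j + 1) / deg H x"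
  proof -
    have "(\<Sum>t. real t * hit_prob H y j t + hit_prob H y j t) = hitting_time H y j + 1"
      if "y \<in> nbrs H x" for y
      using suminf_add[OF summable_hitting_time[OF nV[OF that] j] summable_hit_prob[OF nV[OF that], of j]]
        suminf_hit_prob[OF nV[OF that] j] by (simp add: hitting_time_def)
    thus ?thesis by simp
  qed
  finally have "hitting_time H x j = (\<Sum>y\<in>nbrs H x. hitting_time H y j + 1) / deg H x" .
  thus ?thesis using deg_pos[OF x(1)] by (simp add: lap_def sum.distrib deg_def field_simps)
qed

text \<open>At \<open>j\<close> the value is forced: the Laplacian sums to 0, and the other vertices
  contribute \<open>2 * m\<close> minus the degree of \<open>j\<close>.\<close>

lemma lap_hitting_time:
  assumes x: "x \<in> V" and j: "j \<in> V"
  shows "lap H (\<lambda>x. hitting_time H x j) x = deg H x - (if x = j then 2 * real m else 0)"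
proof (cases "x = j")
  case True
  let ?L = "lap H (\<lambda>x. hitting_time H x j)"
  have "0 = ?L j + (\<Sum>x\<in>V - {j}. ?L x)"
    using sum_lap[OF simple] sum.remove[OF finite_vertices[OF simple] j] by metis
  also have "(\<Sum>x\<in>V - {j}. ?L x) = (\<Sum>x\<in>V - {j}. real (deg H x))"
    using j by (intro sum.cong) (auto simp: lap_hitting_time_off)
  also have "\<dots> = real (\<Sum>x\<in>V. deg H x) - deg H j"
    using sum.remove[OF finite_vertices[OF simple] j, of "\<lambda>x. real (deg H x)"] by simp
  finally show ?thesis using True by (simp only: handshake[OF simple]) simp
qed (use lap_hitting_time_off assms in simp)

text \<open>The maximum principle applies to both differences. From here on, hitting times are found
  by exhibiting a solution and checking it.\<close>

lemma hitting_time_eqI: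
  assumes "g j = 0" "\<And>x. x \<in> V \<Longrightarrow> x \<noteq> j \<Longrightarrow> lap H g x = deg H x" "i \<in> V" "j \<in> V"
  shows "hitting_time H i j = g i"
proof (rule antisym)
  have "lap H (\<lambda>x. hitting_time H x j - g x) x = 0" "lap H (\<lambda>x. g x - hitting_time H x j) x = 0"
    if "x \<in> V" "x \<noteq> j" for x
    using assms(2)[OF that] lap_hitting_time_off[OF that assms(4)] by (simp_all add: lap_diff)
  hence "hitting_time H i j - g i \<le> hitting_time H j j - g j"
    "g i - hitting_time H i j \<le> g j - hitting_time H j j"
    by (intro maximum_principle[of j "\<lambda>x. hitting_time H x j - g x" i]
      maximum_principle[of j "\<lambda>x. g x - hitting_time H x j" i] assms(3,4); simp)+
  thus "hitting_time H i j \<le> g i" "g i \<le> hitting_time H i j"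
    using assms(1) hitting_time_same[OF assms(4)] by simp_all
qed

lemma hitting_time_ge_1:
  assumes "i \<in> V" "j \<in> V" "i \<noteq> j" shows "hitting_time H i j \<ge> 1"
proof -
  have "(\<Sum>y\<in>nbrs H i. hitting_time H y j) \<ge> 0"
    using assms nbrs_subset[OF simple] by (intro sum_nonneg hitting_time_nonneg) auto
  hence "real (deg H i) * 1 \<le> real (deg H i) * hitting_time H i j"
    using lap_hitting_time_off[OF assms(1,3,2)] by (simp add: lap_def)
  thus ?thesis using deg_pos[OF assms(1)] by (simp only: mult_le_cancel_left_pos of_nat_0_less_iff)
qed

text \<open>The sum \<open>k\<close> is harmonic at every vertex, so any vertex may act as the
  exceptional one in the maximum principle and \<open>k\<close> is constant. Hence the description
  in \<open>kemeny\<close> has a unique value.\<close>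

lemma kemeny_eq:
  assumes v: "v \<in> V"
  shows "2 * real m * kemeny H = (\<Sum>j\<in>V. real (deg H j) * hitting_time H v j)"
proof -
  define k where "k i = (\<Sum>j\<in>V. real (deg H j) * hitting_time H i j)" for i
  have "lap H k i = 0" if i: "i \<in> V" for i
  proof -
    have "lap H k i = (\<Sum>j\<in>V. real (deg H j) * (deg H i - (if i = j then 2 * real m else 0)))"
      unfolding k_def[abs_def] lap_sum lap_cmult using i by (simp add: lap_hitting_time)
    also have "\<dots> = real (\<Sum>j\<in>V. deg H j) * deg H i - (\<Sum>j\<in>V. if i = j then deg H j * (2 * real m) else 0)"
      unfolding of_nat_sum sum_distrib_right sum_subtractf[symmetric]
      by (intro sum.cong) (simp_all add: algebra_simps)
    also have "\<dots> = 0"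
      by (simp only: handshake[OF simple]) (use i finite_vertices[OF simple] in simp)
    finally show ?thesis .
  qed
  hence const: "k i = k v" if "i \<in> V" for i
    by (intro antisym maximum_principle) (use v that in auto)
  have stat: "(\<Sum>j\<in>V. stat_dist H j * hitting_time H i j) = k i / (2 * real m)" for i
    by (simp add: stat_dist_def k_def sum_divide_distrib)
  have "kemeny H = k v / (2 * real m)"
    unfolding kemeny_def stat
  proof (rule the_equality)
    show "\<forall>i\<in>V. k i / (2 * real m) = k v / (2 * real m)" by (simp add: const)
  next
    fix x assume "\<forall>i\<in>V. k i / (2 * real m) = x"
    thus "x = k v / (2 * real m)" using v by metis
  qed
  thus ?thesis using m_pos by (simp add: k_def)
qed

end

section \<open>Gluing two graphs at a cut vertex\<close>

definition graph_union :: "'a sgraph \<Rightarrow> 'a sgraph \<Rightarrow> 'a sgraph" where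
  "graph_union G F = \<lparr>vertices = vertices G \<union> vertices F, edges = edges G \<union> edges F\<rparr>"

lemma graph_union_commute: "graph_union G F = graph_union F G"
  by (simp add: graph_union_def Un_commute)

lemma nbrs_graph_union: "nbrs (graph_union G F) x = nbrs G x \<union> nbrs F x"
  by (auto simp: nbrs_def graph_union_def)

locale glued_graphs = G: walk_graph G + F: walk_graph F
  for G F :: "'a sgraph" and v :: 'a +
  assumes cut: "vertices G \<inter> vertices F = {v}"
begin

abbreviation H where "H \<equiv> graph_union G F"

lemma v_in: "v \<in> vertices G" "v \<in> vertices F"
  using cut by auto

text \<open>A common edge would have both ends equal to \<open>v\<close> and be a loop.\<close>

lemma nbrs_disjoint: "nbrs G x \<inter> nbrs F x = {}"
proof -
  have False if "y \<in> nbrs G x" "y \<in> nbrs F x" for y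
  proof -
    have "y \<in> vertices G \<inter> vertices F" "x \<in> vertices G \<inter> vertices F"
      using that nbrs_subset[OF G.simple] nbrs_subset[OF F.simple] nbrs_sym[of y] by blast+
    hence "x = y" using cut by auto
    thus False using that nbrs_irrefl[OF G.simple] by blast
  qed
  thus ?thesis by blast
qed

lemma deg_H: "deg H x = deg G x + deg F x"
  by (simp add: deg_def nbrs_graph_union nbrs_disjoint card_Un_disjoint
      finite_nbrs[OF G.simple] finite_nbrs[OF F.simple])

lemma lap_H: "lap H g x = lap G g x + lap F g x"
  by (simp add: lap_def deg_H nbrs_graph_union nbrs_disjoint sum.union_disjoint algebra_simps
      finite_nbrs[OF G.simple] finite_nbrs[OF F.simple])

lemma card_edges_H: "card (edges H) = card (edges G) + card (edges F)"
proof -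
  have "edges G \<inter> edges F = {}"
  proof (rule ccontr)
    assume "edges G \<inter> edges F \<noteq> {}"
    then obtain e where e: "e \<in> edges G" "e \<in> edges F" by auto
    then obtain x y where "e = {x, y}" using G.simple unfolding simple_graph_def by blast
    with e have "y \<in> nbrs G x \<inter> nbrs F x" by (simp add: nbrs_def)
    thus False using nbrs_disjoint by blast
  qed
  thus ?thesis by (simp add: graph_union_def card_Un_disjoint finite_edges[OF G.simple] finite_edges[OF F.simple])
qed

sublocale H: walk_graph H
proof
  show "simple_graph H"
    unfolding simple_graph_def
  proof (intro conjI ballI)
    show "finite (vertices H)"
      by (simp add: graph_union_def finite_vertices[OF G.simple] finite_vertices[OF F.simple])
    fix e assume "e \<in> edges H"
    then consider "e \<in> edges G" | "e \<in> edges F" by (auto simp: graph_union_def)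
    then obtain x y where "x \<in> vertices H" "y \<in> vertices H" "x \<noteq> y" "e = {x, y}"
    proof cases
      case 1
      with G.simple obtain x y where "x \<in> vertices G" "y \<in> vertices G" "x \<noteq> y" "e = {x, y}"
        unfolding simple_graph_def by metis
      thus ?thesis using that[of x y] by (simp add: graph_union_def)
    next
      case 2
      with F.simple obtain x y where "x \<in> vertices F" "y \<in> vertices F" "x \<noteq> y" "e = {x, y}"
        unfolding simple_graph_def by metis
      thus ?thesis using that[of x y] by (simp add: graph_union_def)
    qed
    thus "\<exists>x\<in>vertices H. \<exists>y\<in>vertices H. x \<noteq> y \<and> e = {x, y}" by metis
  qed
  show "edges H \<noteq> {}" using G.edges_ne by (simp add: graph_union_def)
  define R where "R K = {(s, t). {s, t} \<in> edges K}" for K :: "'a sgraph"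
  have sub: "(R G)\<^sup>* \<subseteq> (R H)\<^sup>*" "(R F)\<^sup>* \<subseteq> (R H)\<^sup>*"
    by (intro rtrancl_mono; auto simp: R_def graph_union_def)+
  have G: "(x, y) \<in> (R G)\<^sup>*" if "x \<in> vertices G" "y \<in> vertices G" for x y
    using G.conn that by (simp add: connected_graph_def R_def)
  have F: "(x, y) \<in> (R F)\<^sup>*" if "x \<in> vertices F" "y \<in> vertices F" for x y
    using F.conn that by (simp add: connected_graph_def R_def)
  have "(x, v) \<in> (R H)\<^sup>* \<and> (v, x) \<in> (R H)\<^sup>*" if "x \<in> vertices H" for x
  proof -
    from that consider "x \<in> vertices G" | "x \<in> vertices F" by (auto simp: graph_union_def)
    thus ?thesis
      by cases (use G[of x v] G[of v x] F[of x v] F[of v x] sub v_in in blast)+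
  qed
  hence "(x, y) \<in> (R H)\<^sup>*" if "x \<in> vertices H" "y \<in> vertices H" for x y
    using that by (meson rtrancl_trans)
  thus "connected_graph H" using v_in by (auto simp: connected_graph_def graph_union_def R_def)
qed

text \<open>The last bracket divided by \<open>2 m\<close> is the effective resistance between \<open>v\<close> and \<open>j\<close>; each
  visit to \<open>v\<close> costs extra excursions into \<open>F\<close>.\<close>

lemma hitting_time_glue:
  assumes j: "j \<in> vertices G"
  shows "hitting_time H v j = hitting_time G v j
    + real F.m / real G.m * (hitting_time G v j + hitting_time G j v)"
proof -
  define q where "q = real F.m / real G.m"
  have q: "q * (2 * real G.m) = 2 * real F.m" using G.m_pos by (simp add: q_def)
  \<comment> \<open>The difference of the times to \<open>j\<close> and to \<open>v\<close> has
    Laplacian \<open>2 * G.m\<close> at \<open>v\<close> and 0 at the other vertices except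
    \<open>j\<close>. The factor \<open>q\<close> turns this into a surplus \<open>2 * F.m\<close>
    at \<open>v\<close>; the constant makes \<open>A\<close> vanish at \<open>j\<close>.\<close>
  define A where "A x = hitting_time G x j
    + q * (hitting_time G x j + hitting_time G j v - hitting_time G x v)" for x
  \<comment> \<open>A walk leaving \<open>F\<close> must pass \<open>v\<close>. The Laplacian on
    \<open>F\<close> has a deficit \<open>2 * F.m\<close> at \<open>v\<close>, which cancels the
    surplus of \<open>A\<close>.\<close>
  define g where "g x = (if x \<in> vertices G then A x else A v + hitting_time F x v)" for x
  have gG: "lap G g x = lap G A x" for x
    by (rule lap_cong[OF G.simple]) (simp add: g_def)
  have gF: "lap F g x = lap F (\<lambda>x. A v + hitting_time F x v) x" for x
  proof (rule lap_cong[OF F.simple])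
    fix y assume "y \<in> vertices F"
    moreover have "y = v" if "y \<in> vertices G" using that \<open>y \<in> vertices F\<close> cut by auto
    ultimately show "g y = A v + hitting_time F y v"
      using v_in F.hitting_time_same by (auto simp: g_def)
  qed
  have LG: "lap G A x = deg G x + (if x = v then 2 * real F.m else 0)"
    if x: "x \<in> vertices G" "x \<noteq> j" for x
    using x j v_in q unfolding A_def
    by (simp add: lap_add lap_diff lap_cmult lap_const G.lap_hitting_time algebra_simps)
  have LF: "lap F (\<lambda>x. A v + hitting_time F x v) x = deg F x - (if x = v then 2 * real F.m else 0)"
    if x: "x \<in> vertices F" for x
    using x v_in by (simp add: lap_add lap_const F.lap_hitting_time)
  have out: "lap K f x = 0" "deg K x = 0" if "simple_graph K" "x \<notin> vertices K" for K :: "'a sgraph" and f x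
    using nbrs_outside[OF that] by (simp_all add: lap_def deg_def)
  have "hitting_time H v j = g v"
  proof (rule H.hitting_time_eqI)
    show "g j = 0" using j v_in by (simp add: g_def A_def G.hitting_time_same)
    show "v \<in> vertices H" "j \<in> vertices H" using j v_in by (auto simp: graph_union_def)
    fix x assume x: "x \<in> vertices H" "x \<noteq> j"
    consider "x = v" | "x \<in> vertices G" "x \<notin> vertices F" "x \<noteq> v" | "x \<in> vertices F" "x \<notin> vertices G" "x \<noteq> v"
      using x(1) cut v_in by (auto simp: graph_union_def)
    thus "lap H g x = deg H x"
      unfolding lap_H deg_H gG gF
      by cases (use x v_in in \<open>simp_all add: LG LF out[OF G.simple] out[OF F.simple]\<close>)
  qed
  thus ?thesis using v_in by (simp add: g_def A_def G.hitting_time_same q_def)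
qed

end

text \<open>For a vertex \<open>v\<close> of a connected graph with \<open>m > 0\<close> edges, this
  is \<open>2 * m\<close> times Kemeny's constant, by \<open>kemeny_eq\<close>.\<close>

definition out_time :: "'a sgraph \<Rightarrow> 'a \<Rightarrow> real" where
  "out_time H v = (\<Sum>j\<in>vertices H. real (deg H j) * hitting_time H v j)"

text \<open>Divided by \<open>2 * m\<close>, this is the expected time to reach \<open>v\<close>
  from a stationary start.\<close>

definition in_time :: "'a sgraph \<Rightarrow> 'a \<Rightarrow> real" where
  "in_time H v = (\<Sum>j\<in>vertices H. real (deg H j) * hitting_time H j v)"

context glued_graphs
begin

lemma sum_glue:
  "(\<Sum>j\<in>vertices G. real (deg G j) * hitting_time H v j)
    = out_time G v + real F.m / real G.m * (out_time G v + in_time G v)"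
  unfolding out_time_def in_time_def sum_distrib_left sum.distrib[symmetric]
  by (intro sum.cong) (simp_all add: hitting_time_glue distrib_left mult.left_commute)

text \<open>Degrees add, so the sum over targets splits into one for each piece;
  \<open>sum_glue\<close> evaluates both, the second with the roles exchanged.\<close>

theorem kemeny_glue:
  "2 * (real G.m + real F.m) * kemeny H
    = out_time G v + real F.m / real G.m * (out_time G v + in_time G v)
    + (out_time F v + real G.m / real F.m * (out_time F v + in_time F v))"
proof -
  interpret swap: glued_graphs F G v
    by unfold_locales (use cut in blast)
  \<comment> \<open>Degrees in a piece vanish outside it. The shared vertex \<open>v\<close> occurs
    in both sums, each time with its degree in that piece.\<close>
  have ext: "(\<Sum>j\<in>vertices H. real (deg K j) * hitting_time H v j)
      = (\<Sum>j\<in>vertices K. real (deg K j) * hitting_time H v j)"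
    if "simple_graph K" "vertices K \<subseteq> vertices H" for K
    using that finite_vertices[OF H.simple] nbrs_outside[OF that(1)]
    by (intro sum.mono_neutral_right) (auto simp: deg_def)
  have "2 * (real G.m + real F.m) * kemeny H = (\<Sum>j\<in>vertices H. real (deg H j) * hitting_time H v j)"
    using H.kemeny_eq[of v] v_in by (simp add: card_edges_H) (simp add: graph_union_def)
  also have "\<dots> = (\<Sum>j\<in>vertices H. real (deg G j) * hitting_time H v j)
      + (\<Sum>j\<in>vertices H. real (deg F j) * hitting_time H v j)"
    by (simp add: deg_H sum.distrib algebra_simps)
  also have "\<dots> = (\<Sum>j\<in>vertices G. real (deg G j) * hitting_time H v j)
      + (\<Sum>j\<in>vertices F. real (deg F j) * hitting_time H v j)"
    by (intro arg_cong2[of _ _ _ _ "(+)"] ext G.simple F.simple) (auto simp: graph_union_def)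
  finally show ?thesis
    using sum_glue swap.sum_glue by (simp add: graph_union_commute[of F G])
qed

end

text \<open>Every vertex other than \<open>v\<close> needs at least one step, and their degrees sum
  to at least \<open>m\<close> because \<open>v\<close> has degree at most \<open>m\<close>.\<close>

lemma (in walk_graph) in_time_ge:
  assumes v: "v \<in> V" shows "in_time H v \<ge> real m"
proof -
  note fin = finite_vertices[OF simple]
  have "real (\<Sum>j\<in>V. deg H j) = real (deg H v) + (\<Sum>j\<in>V - {v}. real (deg H j))"
    using sum.remove[OF fin v, of "\<lambda>j. real (deg H j)"] by simp
  hence "real m \<le> (\<Sum>j\<in>V - {v}. real (deg H j))"
    using deg_le_card_edges[OF simple, of v] by (simp add: handshake[OF simple] flip: of_nat_sum)
  also have "\<dots> \<le> (\<Sum>j\<in>V - {v}. real (deg H j) * hitting_time H j v)"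
    using hitting_time_ge_1 v by (intro sum_mono) (simp add: mult_le_cancel_left1)
  also have "\<dots> = in_time H v"
    unfolding in_time_def using sum.remove[OF fin v, of "\<lambda>j. real (deg H j) * hitting_time H j v"]
      hitting_time_same[OF v] by simp
  finally show ?thesis .
qed

section \<open>The two attached pieces: K4 minus an edge, and K4\<close>

lemma walk_graph_hub:
  assumes "simple_graph H" "v \<in> vertices H" "edges H \<noteq> {}"
    and hub: "\<And>x. x \<in> vertices H \<Longrightarrow> x \<noteq> v \<Longrightarrow> {v, x} \<in> edges H"
  shows "walk_graph H"
proof
  define R where "R = {(s, t). {s, t} \<in> edges H}"
  have "(x, v) \<in> R\<^sup>*" "(v, x) \<in> R\<^sup>*" if "x \<in> vertices H" for x
    using hub[OF that] by (cases "x = v"; force simp: R_def insert_commute)+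
  hence "(x, y) \<in> R\<^sup>*" if "x \<in> vertices H" "y \<in> vertices H" for x y
    using that by (meson rtrancl_trans)
  thus "connected_graph H" using assms(2) by (auto simp: connected_graph_def R_def)
qed (use assms in auto)

definition diamond :: "'a \<Rightarrow> 'a \<Rightarrow> 'a \<Rightarrow> 'a \<Rightarrow> 'a sgraph" where
  "diamond v a b c = \<lparr>vertices = {v, a, b, c}, edges = {{v, a}, {v, b}, {v, c}, {a, b}, {b, c}}\<rparr>"

definition tetrahedron :: "'a \<Rightarrow> 'a \<Rightarrow> 'a \<Rightarrow> 'a \<Rightarrow> 'a sgraph" where
  "tetrahedron v a b c =
    \<lparr>vertices = {v, a, b, c}, edges = {{v, a}, {v, b}, {v, c}, {a, b}, {b, c}, {a, c}}\<rparr>"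

context
  fixes v a b c :: 'a
  assumes dist: "distinct [v, a, b, c]"
begin

lemma distinct_ne: "v \<noteq> a" "v \<noteq> b" "v \<noteq> c" "a \<noteq> b" "b \<noteq> c" "a \<noteq> c"
    "a \<noteq> v" "b \<noteq> v" "c \<noteq> v" "b \<noteq> a" "c \<noteq> b" "c \<noteq> a"
  using dist by auto

lemma walk_graph_diamond: "walk_graph (diamond v a b c)"
  by (rule walk_graph_hub[of _ v]) (use distinct_ne in \<open>auto simp: diamond_def simple_graph_def\<close>)

lemma walk_graph_tetrahedron: "walk_graph (tetrahedron v a b c)"
  by (rule walk_graph_hub[of _ v]) (use distinct_ne in \<open>auto simp: tetrahedron_def simple_graph_def\<close>)

lemma card_edges_diamond: "card (edges (diamond v a b c)) = 5"
  by (simp add: diamond_def doubleton_eq_iff distinct_ne)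

lemma card_edges_tetrahedron: "card (edges (tetrahedron v a b c)) = 6"
  by (simp add: tetrahedron_def doubleton_eq_iff distinct_ne)

lemma nbrs_diamond:
  "nbrs (diamond v a b c) v = {a, b, c}" "nbrs (diamond v a b c) b = {v, a, c}"
  "nbrs (diamond v a b c) a = {v, b}" "nbrs (diamond v a b c) c = {v, b}"
  by (auto simp: nbrs_def diamond_def doubleton_eq_iff distinct_ne)

lemma nbrs_tetrahedron:
  "nbrs (tetrahedron v a b c) v = {a, b, c}" "nbrs (tetrahedron v a b c) b = {v, a, c}"
  "nbrs (tetrahedron v a b c) a = {v, b, c}" "nbrs (tetrahedron v a b c) c = {v, a, b}"
  by (auto simp: nbrs_def tetrahedron_def doubleton_eq_iff distinct_ne)

text \<open>The premises are the first-step equations multiplied by the degrees, which are 3 at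
  \<open>v\<close> and \<open>b\<close> and 2 at \<open>a\<close> and \<open>c\<close>.\<close>

lemma hitting_time_diamond:
  assumes "g j = 0" "i \<in> {v, a, b, c}" "j \<in> {v, a, b, c}"
    and "j \<noteq> v \<Longrightarrow> 3 * g v = 3 + g a + g b + g c" "j \<noteq> b \<Longrightarrow> 3 * g b = 3 + g v + g a + g c"
    and "j \<noteq> a \<Longrightarrow> 2 * g a = 2 + g v + g b" "j \<noteq> c \<Longrightarrow> 2 * g c = 2 + g v + g b"
  shows "hitting_time (diamond v a b c) i j = g i"
proof (rule walk_graph.hitting_time_eqI[OF walk_graph_diamond])
  fix x assume "x \<in> vertices (diamond v a b c)" "x \<noteq> j"
  thus "lap (diamond v a b c) g x = deg (diamond v a b c) x"
    using assms(4-7) by (auto simp: diamond_def[THEN arg_cong[of _ _ vertices]] lap_def deg_def nbrs_diamond distinct_ne)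
qed (use assms in \<open>auto simp: diamond_def\<close>)

text \<open>Off the target, each step hits it with probability 1/3, so the time is geometric with
  mean 3.\<close>

lemma hitting_time_tetrahedron:
  assumes "i \<in> {v, a, b, c}" "j \<in> {v, a, b, c}"
  shows "hitting_time (tetrahedron v a b c) i j = (if i = j then 0 else 3)"
proof (rule walk_graph.hitting_time_eqI[OF walk_graph_tetrahedron])
  fix x assume "x \<in> vertices (tetrahedron v a b c)" "x \<noteq> j"
  thus "lap (tetrahedron v a b c) (\<lambda>i. if i = j then 0 else 3) x = deg (tetrahedron v a b c) x"
    using assms(2)
    by (auto simp: tetrahedron_def[THEN arg_cong[of _ _ vertices]] lap_def deg_def nbrs_tetrahedron distinct_ne)
qed (use assms in \<open>auto simp: tetrahedron_def\<close>)

lemma time_diamond: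
  "out_time (diamond v a b c) v = 47 / 2" "in_time (diamond v a b c) v = 33 / 2"
proof -
  let ?D = "diamond v a b c"
  note h = hitting_time_diamond
  \<comment> \<open>By symmetry \<open>a\<close> and \<open>c\<close> share a time s; with r the
    time from \<open>b\<close>, the equations are 2s = 2 + r and 3r = 3 + 2s.\<close>
  have "hitting_time ?D i v = ((\<lambda>_. 9/4)(v := 0, b := 5/2)) i" if "i \<in> {v, a, b, c}" for i
    by (rule h) (use that in \<open>auto simp: distinct_ne\<close>)
  hence tv: "hitting_time ?D v v = 0" "hitting_time ?D a v = 9/4" "hitting_time ?D b v = 5/2"
    "hitting_time ?D c v = 9/4" by (auto simp: distinct_ne)
  \<comment> \<open>Exchanging \<open>v\<close> and \<open>b\<close> is a symmetry, so the same
    values recur.\<close>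
  have "hitting_time ?D v b = ((\<lambda>_. 9/4)(b := 0, v := 5/2)) v"
    by (rule h) (auto simp: distinct_ne)
  \<comment> \<open>Here \<open>v\<close> and \<open>b\<close> share a time s, and \<open>c\<close>
    has time 1 + s, so 2s = 3 + (1 + s).\<close>
  moreover have "hitting_time ?D v a = ((\<lambda>_. 4)(a := 0, c := 5)) v"
    by (rule h) (auto simp: distinct_ne)
  moreover have "hitting_time ?D v c = ((\<lambda>_. 4)(c := 0, a := 5)) v"
    by (rule h) (auto simp: distinct_ne)
  ultimately show "out_time ?D v = 47 / 2" "in_time ?D v = 33 / 2"
    using tv by (simp_all add: out_time_def in_time_def diamond_def[THEN arg_cong[of _ _ vertices]]
        deg_def nbrs_diamond distinct_ne)
qed

lemma time_tetrahedron:
  "out_time (tetrahedron v a b c) v = 27" "in_time (tetrahedron v a b c) v = 27"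
  by (simp_all add: out_time_def in_time_def tetrahedron_def[THEN arg_cong[of _ _ vertices]]
      deg_def nbrs_tetrahedron distinct_ne hitting_time_tetrahedron)

end

section \<open>Comparison of the two Kemeny constants\<close>

theorem theorem4p13:
  fixes G Gbar Ghat Gstar :: "'a sgraph" and v a b c :: 'a
  assumes "simple_graph G" and "connected_graph G"
    and "card (edges G) \<ge> 2"
    and "v \<in> vertices G"
    and "distinct [a, b, c]" and "{a, b, c} \<inter> vertices G = {}"
    and "Gbar = add_pendant (add_pendant (add_pendant G v a) v b) v c"
    and "Ghat = add_edge (add_edge Gbar a b) b c"
    and "Gstar = add_edge (add_edge (add_edge Gbar a b) b c) a c"
  shows "kemeny Gstar > kemeny Ghat"
proof -
  have dist: "distinct [v, a, b, c]" using assms(4-6) by auto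
  have hat: "Ghat = graph_union G (diamond v a b c)"
    and star: "Gstar = graph_union G (tetrahedron v a b c)"
    using assms(4) unfolding assms(7-9)
    by (auto simp: add_pendant_def add_edge_def graph_union_def diamond_def tetrahedron_def)
  interpret G: walk_graph G
    using assms(1-3) by unfold_locales auto
  interpret D: walk_graph "diamond v a b c" by (rule walk_graph_diamond[OF dist])
  interpret T: walk_graph "tetrahedron v a b c" by (rule walk_graph_tetrahedron[OF dist])
  interpret GD: glued_graphs G "diamond v a b c" v
    by unfold_locales (use assms(4,6) in \<open>auto simp: diamond_def\<close>)
  interpret GT: glued_graphs G "tetrahedron v a b c" v
    by unfold_locales (use assms(4,6) in \<open>auto simp: tetrahedron_def\<close>)
  define n S T where "n = real (card (edges G))" and "S = out_time G v" and "T = in_time G v"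
  have n: "n \<ge> 2" using assms(3) by (simp add: n_def)
  define q where "q = (S + T) / n"
  have q: "n * q = S + T" using n by (simp add: q_def)
  \<comment> \<open>The coefficients of \<open>n\<close> are (47/2 + 33/2) / 5 = 8 and (27 + 27) / 6
    = 9.\<close>
  have K: "2 * (n + 5) * kemeny Ghat = S + 5 * q + 47 / 2 + 8 * n"
    "2 * (n + 6) * kemeny Gstar = S + 6 * q + 27 + 9 * n"
    using GD.kemeny_glue GT.kemeny_glue
    by (simp_all add: hat star card_edges_diamond[OF dist] card_edges_tetrahedron[OF dist]
        time_diamond[OF dist] time_tetrahedron[OF dist] n_def S_def T_def q_def)
  have "T \<ge> n" using G.in_time_ge[OF assms(4)] by (simp add: T_def n_def)
  moreover have "n * n \<ge> 2 * 2" using n by (intro mult_mono) auto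
  ultimately have "T + n * n + n / 2 - 6 > 0" using n by linarith
  \<comment> \<open>The coefficient of \<open>q\<close> is 6(n + 5) - 5(n + 6) = n, and
    \<open>n * q - S = T\<close>, so \<open>S\<close> cancels.\<close>
  also have "T + n * n + n / 2 - 6
      = (n + 5) * (S + 6 * q + 27 + 9 * n) - (n + 6) * (S + 5 * q + 47 / 2 + 8 * n)"
    using q by (simp add: algebra_simps add_divide_distrib)
  also have "\<dots> = 2 * (n + 5) * (n + 6) * (kemeny Gstar - kemeny Ghat)"
    unfolding K[symmetric] by (simp add: algebra_simps)
  finally have "0 < 2 * (n + 5) * (n + 6) * (kemeny Gstar - kemeny Ghat)" .
  moreover have "2 * (n + 5) * (n + 6) > 0" using n by (intro mult_pos_pos) auto
  ultimately have "kemeny Gstar - kemeny Ghat > 0" by (rule zero_less_mult_pos)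
  thus ?thesis by simp
qed

end
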